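(* Let $\ell^2\in\{+1,-1\}$ be fixed. For all $o_1=q_1+\ell p_1$ and $o_2=q_2+\ell p_2$ with $q_1,p_1,q_2,p_2\in\mathbb{H}$, one has $$M(o_1)\circledast M(o_2)=M(o_1o_2),$$ where $\circledast$ is the interlaced product of $2\times 2$ quaternionic matrices, $M$ is the linear map $M(q+\ell p)=\begin{pmatrix} q & \ell^2 p^{*}\\ p & q^{*}\end{pmatrix}$, and $o_1o_2$ is the Cayley--Dickson product $$o_1o_2=q_1q_2+\ell^2\,p_2p_1^{*}+\ell\,(q_2p_1+q_1^{*}p_2).$$
   Context: $\mathbb{H}$ denotes the real quaternions and $^{*}$ denotes quaternionic conjugation. A (split) octonion is a formal expression $o=q+\ell p$ with $q,p\in\mathbb{H}$, i.e. a pair $(q,p)\in\mathbb{H}\oplus\mathbb{H}\,\ell$, where $\ell^2=\pm1$ is a fixed real sign (the two signs cover the division and split cases). Addition is componentwise, and multiplication is the Cayley--Dickson product $$(q_1+\ell p_1)(q_2+\ell p_2)=q_1q_2+\ell^2\,p_2p_1^{*}+\ell\,(q_2p_1+q_1^{*}p_2).$$ The map $M$ from (split) octonions to $2\times2$ matrices over $\mathbb{H}$ is $$M(q+\ell p)=\begin{pmatrix} q & \ell^2\,p^{*}\\ p & q^{*}\end{pmatrix}.$$ The interlaced product $\circledast$ of $2\times 2$ matrices over $\mathbb{H}$ is obtained from the usual matrix product by reversing the order of the factors in one of the two products in each entry: $$\begin{pmatrix} a & b\\ c & d\end{pmatrix}\circledast\begin{pmatrix} a' & b'\\ c' & d'\end{pmatrix}=\begin{pmatrix}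 aa'+c'b & b'a+bd'\\ a'c+dc' & cb'+d'd\end{pmatrix}.$$ *)

theory Defs
  imports "HOL-Analysis.Analysis"
begin

datatype quat = Quat (qRe: real) (qIm1: real) (qIm2: real) (qIm3: real)

lemma quat_eq_iff:
  "x = y \<longleftrightarrow> qRe x = qRe y \<and> qIm1 x = qIm1 y \<and> qIm2 x = qIm2 y \<and> qIm3 x = qIm3 y"
  by (cases x; cases y) auto

instantiation quat :: real_algebra_1
begin

definition zero_quat :: quat where "0 = Quat 0 0 0 0"

definition one_quat :: quat where "1 = Quat 1 0 0 0"

definition plus_quat :: "quat \<Rightarrow> quat \<Rightarrow> quat" where
  "x + y = Quat (qRe x + qRe y) (qIm1 x + qIm1 y) (qIm2 x + qIm2 y) (qIm3 x + qIm3 y)"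

definition uminus_quat :: "quat \<Rightarrow> quat" where
  "- x = Quat (- qRe x) (- qIm1 x) (- qIm2 x) (- qIm3 x)"

definition minus_quat :: "quat \<Rightarrow> quat \<Rightarrow> quat" where
  "x - y = Quat (qRe x - qRe y) (qIm1 x - qIm1 y) (qIm2 x - qIm2 y) (qIm3 x - qIm3 y)"

definition scaleR_quat :: "real \<Rightarrow> quat \<Rightarrow> quat" where
  "r *\<^sub>R x = Quat (r * qRe x) (r * qIm1 x) (r * qIm2 x) (r * qIm3 x)"

definition times_quat :: "quat \<Rightarrow> quat \<Rightarrow> quat" where
  "x * y = Quat
    (qRe x * qRe y - qIm1 x * qIm1 y - qIm2 x * qIm2 y - qIm3 x * qIm3 y)
    (qRe x * qIm1 y + qIm1 x * qRe y + qIm2 x * qIm3 y - qIm3 x * qIm2 y)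
    (qRe x * qIm2 y - qIm1 x * qIm3 y + qIm2 x * qRe y + qIm3 x * qIm1 y)
    (qRe x * qIm3 y + qIm1 x * qIm2 y - qIm2 x * qIm1 y + qIm3 x * qRe y)"

instance
  by standard
    (auto simp: quat_eq_iff zero_quat_def one_quat_def plus_quat_def uminus_quat_def
      minus_quat_def scaleR_quat_def times_quat_def algebra_simps)

end

lemma quat_units:
  defines "i \<equiv> Quat 0 1 0 0" and "j \<equiv> Quat 0 0 1 0" and "k \<equiv> Quat 0 0 0 1"
  shows "i * i = - 1" "j * j = - 1" "k * k = - 1" "i * j = k" "j * i = - k"
  by (auto simp: i_def j_def k_def times_quat_def uminus_quat_def one_quat_def)

definition qcnj :: "quat \<Rightarrow> quat" where
  "qcnj x = Quat (qRe x) (- qIm1 x) (- qIm2 x) (- qIm3 x)"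

text \<open>
  The pair \<open>(q, p)\<close> stands for \<open>q + \<ell> p\<close>. Its vector space structure is the componentwise one
  of the product type. The product depends on the sign \<open>\<epsilon> = \<ell>\<^sup>2\<close>, so it is a
  function of \<open>\<epsilon>\<close>.
\<close>
type_synonym octonion = "quat \<times> quat"

fun oct_mult :: "real \<Rightarrow> octonion \<Rightarrow> octonion \<Rightarrow> octonion" where
  "oct_mult \<epsilon> (q1, p1) (q2, p2) =
    (q1 * q2 + \<epsilon> *\<^sub>R (p2 * qcnj p1), q2 * p1 + qcnj q1 * p2)"

definition mat2 :: "'a \<Rightarrow> 'a \<Rightarrow> 'a \<Rightarrow> 'a \<Rightarrow> 'a::zero ^ 2 ^ 2" where
  "mat2 a b c d = vector [vector [a, b], vector [c, d]]"

fun oct_mat :: "real \<Rightarrow> octonion \<Rightarrow> quat ^ 2 ^ 2" where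
  "oct_mat \<epsilon> (q, p) = mat2 q (\<epsilon> *\<^sub>R qcnj p)
                           p (qcnj q)"

definition interlaced :: "quat ^ 2 ^ 2 \<Rightarrow> quat ^ 2 ^ 2 \<Rightarrow> quat ^ 2 ^ 2"
    (infixl "\<circledast>" 70) where
  "A \<circledast> B =
    (let a = A $ 1 $ 1; b = A $ 1 $ 2; c = A $ 2 $ 1; d = A $ 2 $ 2;
         a' = B $ 1 $ 1; b' = B $ 1 $ 2; c' = B $ 2 $ 1; d' = B $ 2 $ 2
     in mat2 (a * a' + c' * b) (b' * a + b * d')
             (a' * c + d * c') (c * b' + d' * d))"

lemma interlaced_mat2:
  "mat2 a b c d \<circledast> mat2 a' b' c' d' =
    mat2 (a * a' + c' * b) (b' * a + b * d')
         (a' * c + d * c') (c * b' + d' * d)"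
  by (simp add: interlaced_def mat2_def)

lemma linear_oct_mat: "linear (oct_mat \<epsilon>)"
proof (rule linearI)
  show "oct_mat \<epsilon> (x + y) = oct_mat \<epsilon> x + oct_mat \<epsilon> y" for x y
    by (cases x; cases y)
      (simp add: vec_eq_iff forall_2 mat2_def quat_eq_iff qcnj_def plus_quat_def
        scaleR_quat_def algebra_simps)
  show "oct_mat \<epsilon> (r *\<^sub>R x) = r *\<^sub>R oct_mat \<epsilon> x" for r x
    by (cases x)
      (simp add: vec_eq_iff forall_2 mat2_def quat_eq_iff qcnj_def scaleR_quat_def)
qed

end

theory Submission
  imports Defs
begin

text \<open>
  Quaternionic conjugation is a real-linear involution that reverses products. In the matrix
  \<open>(a b; c d)\<close> of an octonion the second column is determined by the first, through \<open>d = a\<^sup>*\<close>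
  and \<open>b = \<epsilon> c\<^sup>*\<close>. The first column of the interlaced product spells out the two components of
  the Cayley--Dickson product. Conjugating that column reverses the factors in every term and
  exchanges \<open>a\<close> with \<open>d\<close> and, up to \<open>\<epsilon>\<close>, \<open>b\<close> with \<open>c\<close>; the interlacing is chosen so that
  this produces exactly the terms of the second column. The ordinary matrix product keeps the
  order of the factors in both columns, so for the noncommuting quaternions it lacks this symmetry.
\<close>

lemma qcnj_mult: "qcnj (x * y) = qcnj y * qcnj x"
  by (simp add: qcnj_def times_quat_def algebra_simps)

lemma qcnj_add: "qcnj (x + y) = qcnj x + qcnj y"
  by (simp add: qcnj_def plus_quat_def)

lemma qcnj_scaleR: "qcnj (r *\<^sub>R x) = r *\<^sub>R qcnj x"
  by (simp add: qcnj_def scaleR_quat_def)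

lemma qcnj_qcnj: "qcnj (qcnj x) = x"
  by (simp add: qcnj_def)

theorem proposition2p4:
  fixes \<epsilon> :: real and o1 o2 :: octonion and q1 p1 q2 p2 :: quat
  assumes "\<epsilon> = 1 \<or> \<epsilon> = -1"
    and "o1 = (q1, p1)" and "o2 = (q2, p2)"
  shows "oct_mat \<epsilon> o1 \<circledast> oct_mat \<epsilon> o2 = oct_mat \<epsilon> (oct_mult \<epsilon> o1 o2)"
proof -
  \<comment> \<open>The first column agrees by definition; only the second needs the laws of conjugation.\<close>
  have upper_right: "(\<epsilon> *\<^sub>R qcnj p2) * q1 + (\<epsilon> *\<^sub>R qcnj p1) * qcnj q2
      = \<epsilon> *\<^sub>R qcnj (q2 * p1 + qcnj q1 * p2)"
    by (simp add: qcnj_mult qcnj_add qcnj_qcnj scaleR_add_right add.commute)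
  have lower_right: "p1 * (\<epsilon> *\<^sub>R qcnj p2) + qcnj q2 * qcnj q1
      = qcnj (q1 * q2 + \<epsilon> *\<^sub>R (p2 * qcnj p1))"
    by (simp add: qcnj_mult qcnj_add qcnj_scaleR qcnj_qcnj add.commute)
  show ?thesis
    by (simp add: assms(2,3) interlaced_mat2 upper_right [simplified] lower_right [simplified])
qed

end
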